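(* Let $G=\langle V,E,L\rangle$ and $G'=\langle V',E',L'\rangle$ be finite fuzzy graphs. Algorithm B (described in the context), run on $G$ and $G'$ with any choices of iteration orders and of the pairs extracted from $R$, always terminates and returns the largest directed simulation between $G$ and $G'$.
   Context: A fuzzy graph over finite sets $\Sigma_V,\Sigma_E$ is $G=\langle V,E,L\rangle$ with $E: V\times\Sigma_E\times V\to[0,1]$, $L: V\to(\Sigma_V\to[0,1])$; $f\le g$ for $f,g:\Sigma_V\to[0,1]$ means pointwise. $Z\subseteq V\times V'$ (possibly empty) is a directed simulation between $G$ and $G'=\langle V',E',L'\rangle$ if for all $x,y\in V$, $x',y'\in V'$, $r\in\Sigma_E$: $(x,x')\in Z$ implies $L(x)\le L'(x')$; $(x,x')\in Z$ and $E(x,r,y)>0$ imply there is $y'\in V'$ with $(y,y')\in Z$ and $E(x,r,y)\le E'(x',r,y')$; $(x,x')\in Z$ and $E'(x',r,y')>0$ imply there is $y\in V$ with $(y,y')\in Z$ and $E'(x',r,y')\le E(x,r,y)$. The largest directed simulation is the union of all directed simulations. Notation: $\mathrm{Next}_r(x)=\{y\in V:E(x,r,y)>0\}$, $\mathrm{Prev}_r(y)=\{x\in V: E(x,r,y)>0\}$, $\mathrm{Next}'_r(x')=\{y'\in V':E'(x',r,y')>0\}$, $\mathrm{Prev}'_r(y')=\{x'\in V':E'(x',r,y')>0\}$; suprema in $[0,1]$, $\sup\emptyset=0$. Algorithm B maintains $Z,R\subseteq V\times V'$. ProcessPrev$(r,y,x')$: let $d=\sup\{E'(x',r,y')\mid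 y'\in\mathrm{Next}'_r(x'),(y,y')\in Z\cup R\}$; for each $x\in\mathrm{Prev}_r(y)$, if $E(x,r,y)>d$ and $(x,x')\in Z$, move $(x,x')$ from $Z$ to $R$. ProcessPrev$'(r,x,y')$: let $d=\sup\{E(x,r,y)\mid y\in\mathrm{Next}_r(x),(y,y')\in Z\cup R\}$; for each $x'\in\mathrm{Prev}'_r(y')$, if $E'(x',r,y')>d$ and $(x,x')\in Z$, move $(x,x')$ from $Z$ to $R$. Algorithm B: $Z:=\{(x,x')\mid L(x)\le L'(x')\}$, $R:=\emptyset$; for each $(r,y,x')\in\Sigma_E\times V\times V'$ call ProcessPrev$(r,y,x')$; for each $(r,x,y')\in\Sigma_E\times V\times V'$ call ProcessPrev$'(r,x,y')$; while $R\ne\emptyset$: remove some pair $(y,y')$ from $R$, for each $r\in\Sigma_E$ and $x'\in\mathrm{Prev}'_r(y')$ call ProcessPrev$(r,y,x')$, and for each $r\in\Sigma_E$ and $x\in\mathrm{Prev}_r(y)$ call ProcessPrev$'(r,x,y')$; return $Z$. *)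

theory Defs
  imports Complex_Main
begin

record ('v, 'r, 'a) fuzzy_graph =
  verts :: "'v set"
  edge :: "'v \<Rightarrow> 'r \<Rightarrow> 'v \<Rightarrow> real"
  label :: "'v \<Rightarrow> 'a \<Rightarrow> real"

text \<open>
  The values of \<open>edge\<close> and \<open>label\<close> outside the vertex set and the alphabets are unconstrained;
  all definitions below only refer to arguments inside these sets.
\<close>

definition is_fuzzy_graph :: "'a set \<Rightarrow> 'r set \<Rightarrow> ('v, 'r, 'a) fuzzy_graph \<Rightarrow> bool" where
  "is_fuzzy_graph \<Sigma>V \<Sigma>E G \<longleftrightarrow>
     finite \<Sigma>V \<and> finite \<Sigma>E \<and>
     (\<forall>x\<in>verts G. \<forall>r\<in>\<Sigma>E. \<forall>y\<in>verts G. edge G x r y \<in> {0..1}) \<and>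
     (\<forall>x\<in>verts G. \<forall>a\<in>\<Sigma>V. label G x a \<in> {0..1})"

definition finite_fuzzy_graph :: "'a set \<Rightarrow> 'r set \<Rightarrow> ('v, 'r, 'a) fuzzy_graph \<Rightarrow> bool" where
  "finite_fuzzy_graph \<Sigma>V \<Sigma>E G \<longleftrightarrow> is_fuzzy_graph \<Sigma>V \<Sigma>E G \<and> finite (verts G)"

definition label_le ::
  "'a set \<Rightarrow> ('v, 'r, 'a) fuzzy_graph \<Rightarrow> ('w, 'r, 'a) fuzzy_graph \<Rightarrow> 'v \<Rightarrow> 'w \<Rightarrow> bool" where
  "label_le \<Sigma>V G G' x x' \<longleftrightarrow> (\<forall>a\<in>\<Sigma>V. label G x a \<le> label G' x' a)"

definition directed_simulation ::
  "'a set \<Rightarrow> 'r set \<Rightarrow> ('v, 'r, 'a) fuzzy_graph \<Rightarrow> ('w, 'r, 'a) fuzzy_graph \<Rightarrow> ('v \<times> 'w) set \<Rightarrow> bool"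
where
  "directed_simulation \<Sigma>V \<Sigma>E G G' Z \<longleftrightarrow>
     Z \<subseteq> verts G \<times> verts G' \<and>
     (\<forall>x\<in>verts G. \<forall>x'\<in>verts G'. (x, x') \<in> Z \<longrightarrow> label_le \<Sigma>V G G' x x') \<and>
     (\<forall>x\<in>verts G. \<forall>y\<in>verts G. \<forall>x'\<in>verts G'. \<forall>r\<in>\<Sigma>E. (x, x') \<in> Z \<and> edge G x r y > 0 \<longrightarrow>
        (\<exists>y'\<in>verts G'. (y, y') \<in> Z \<and> edge G x r y \<le> edge G' x' r y')) \<and>
     (\<forall>x\<in>verts G. \<forall>x'\<in>verts G'. \<forall>y'\<in>verts G'. \<forall>r\<in>\<Sigma>E. (x, x') \<in> Z \<and> edge G' x' r y' > 0 \<longrightarrow>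
        (\<exists>y\<in>verts G. (y, y') \<in> Z \<and> edge G' x' r y' \<le> edge G x r y))"

definition largest_directed_simulation ::
  "'a set \<Rightarrow> 'r set \<Rightarrow> ('v, 'r, 'a) fuzzy_graph \<Rightarrow> ('w, 'r, 'a) fuzzy_graph \<Rightarrow> ('v \<times> 'w) set" where
  "largest_directed_simulation \<Sigma>V \<Sigma>E G G' = \<Union> {Z. directed_simulation \<Sigma>V \<Sigma>E G G' Z}"

lemma directed_simulation_largest:
  "directed_simulation \<Sigma>V \<Sigma>E G G' (largest_directed_simulation \<Sigma>V \<Sigma>E G G')"
  unfolding largest_directed_simulation_def directed_simulation_def
  by (intro conjI ballI impI) (blast | meson UnionE UnionI mem_Collect_eq)+

definition Next :: "('v, 'r, 'a) fuzzy_graph \<Rightarrow> 'r \<Rightarrow> 'v \<Rightarrow> 'v set" where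
  "Next G r x = {y \<in> verts G. edge G x r y > 0}"

definition Prev :: "('v, 'r, 'a) fuzzy_graph \<Rightarrow> 'r \<Rightarrow> 'v \<Rightarrow> 'v set" where
  "Prev G r y = {x \<in> verts G. edge G x r y > 0}"

text \<open>Supremum in \<open>[0,1]\<close>; on \<^typ>\<open>real\<close> the value of \<open>Sup {}\<close> is unspecified.\<close>

definition sup01 :: "real set \<Rightarrow> real" where
  "sup01 X = (if X = {} then 0 else Sup X)"

definition bound_fwd ::
  "('w, 'r, 'a) fuzzy_graph \<Rightarrow> ('v \<times> 'w) set \<Rightarrow> ('v \<times> 'w) set \<Rightarrow> 'r \<Rightarrow> 'v \<Rightarrow> 'w \<Rightarrow> real" where
  "bound_fwd G' Z R r y x' = sup01 {edge G' x' r y' | y'. y' \<in> Next G' r x' \<and> (y, y') \<in> Z \<union> R}"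

definition bound_bwd ::
  "('v, 'r, 'a) fuzzy_graph \<Rightarrow> ('v \<times> 'w) set \<Rightarrow> ('v \<times> 'w) set \<Rightarrow> 'r \<Rightarrow> 'v \<Rightarrow> 'w \<Rightarrow> real" where
  "bound_bwd G Z R r x y' = sup01 {edge G x r y | y. y \<in> Next G r x \<and> (y, y') \<in> Z \<union> R}"

text \<open>
  The algorithm is given by a nondeterministic small-step semantics. A configuration
  \<open>(Z, R, K)\<close> consists of the two program variables and the stack \<open>K\<close> of statements still to be
  executed. A for-each loop carries the set of elements not yet visited, and the next element is an
  arbitrary member of it, so that the executions cover all iteration orders.

  \<^item> \<open>ForPP T\<close>: for each \<open>(r, y, x') \<in> T\<close> call ProcessPrev\<open>(r, y, x')\<close>.
  \<^item> \<open>ForPP' T\<close>: for each \<open>(r, x, y') \<in> T\<close> call ProcessPrev\<open>'(r, x, y')\<close>.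
  \<^item> \<open>PPLoop r y x' d S\<close>: the loop over \<open>x \<in> S\<close> in the body of ProcessPrev\<open>(r, y, x')\<close>, with the
    value \<open>d\<close> computed on entry.
  \<^item> \<open>PPLoop' r x y' d S\<close>: the loop over \<open>x' \<in> S\<close> in the body of ProcessPrev\<open>'(r, x, y')\<close>, with the
    value \<open>d\<close> computed on entry.
  \<^item> \<open>WhileR\<close>: the main loop, while \<open>R \<noteq> {}\<close>.
\<close>

datatype ('v, 'w, 'r) stmt =
    ForPP "('r \<times> 'v \<times> 'w) set"
  | ForPP' "('r \<times> 'v \<times> 'w) set"
  | PPLoop 'r 'v 'w real "'v set"
  | PPLoop' 'r 'v 'w real "'w set"
  | WhileR

type_synonym ('v, 'w, 'r) config =
  "('v \<times> 'w) set \<times> ('v \<times> 'w) set \<times> ('v, 'w, 'r) stmt list"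

inductive stepB ::
  "'r set \<Rightarrow> ('v, 'r, 'a) fuzzy_graph \<Rightarrow> ('w, 'r, 'a) fuzzy_graph \<Rightarrow>
   ('v, 'w, 'r) config \<Rightarrow> ('v, 'w, 'r) config \<Rightarrow> bool"
  for \<Sigma>E :: "'r set" and G :: "('v, 'r, 'a) fuzzy_graph" and G' :: "('w, 'r, 'a) fuzzy_graph"
where
  ForPP_done: "stepB \<Sigma>E G G' (Z, R, ForPP {} # K) (Z, R, K)"
| ForPP_call: "(r, y, x') \<in> T \<Longrightarrow>
    stepB \<Sigma>E G G' (Z, R, ForPP T # K)
      (Z, R, PPLoop r y x' (bound_fwd G' Z R r y x') (Prev G r y) # ForPP (T - {(r, y, x')}) # K)"
| ForPP'_done: "stepB \<Sigma>E G G' (Z, R, ForPP' {} # K) (Z, R, K)"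
| ForPP'_call: "(r, x, y') \<in> T \<Longrightarrow>
    stepB \<Sigma>E G G' (Z, R, ForPP' T # K)
      (Z, R, PPLoop' r x y' (bound_bwd G Z R r x y') (Prev G' r y') # ForPP' (T - {(r, x, y')}) # K)"
| PPLoop_done: "stepB \<Sigma>E G G' (Z, R, PPLoop r y x' d {} # K) (Z, R, K)"
| PPLoop_move: "x \<in> S \<Longrightarrow> edge G x r y > d \<and> (x, x') \<in> Z \<Longrightarrow>
    stepB \<Sigma>E G G' (Z, R, PPLoop r y x' d S # K)
      (Z - {(x, x')}, insert (x, x') R, PPLoop r y x' d (S - {x}) # K)"
| PPLoop_skip: "x \<in> S \<Longrightarrow> \<not> (edge G x r y > d \<and> (x, x') \<in> Z) \<Longrightarrow>
    stepB \<Sigma>E G G' (Z, R, PPLoop r y x' d S # K) (Z, R, PPLoop r y x' d (S - {x}) # K)"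
| PPLoop'_done: "stepB \<Sigma>E G G' (Z, R, PPLoop' r x y' d {} # K) (Z, R, K)"
| PPLoop'_move: "x' \<in> S \<Longrightarrow> edge G' x' r y' > d \<and> (x, x') \<in> Z \<Longrightarrow>
    stepB \<Sigma>E G G' (Z, R, PPLoop' r x y' d S # K)
      (Z - {(x, x')}, insert (x, x') R, PPLoop' r x y' d (S - {x'}) # K)"
| PPLoop'_skip: "x' \<in> S \<Longrightarrow> \<not> (edge G' x' r y' > d \<and> (x, x') \<in> Z) \<Longrightarrow>
    stepB \<Sigma>E G G' (Z, R, PPLoop' r x y' d S # K) (Z, R, PPLoop' r x y' d (S - {x'}) # K)"
| WhileR_done: "stepB \<Sigma>E G G' (Z, {}, WhileR # K) (Z, {}, K)"
| WhileR_iter: "(y, y') \<in> R \<Longrightarrow>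
    stepB \<Sigma>E G G' (Z, R, WhileR # K)
      (Z, R - {(y, y')},
       ForPP {(r, y, x') | r x'. r \<in> \<Sigma>E \<and> x' \<in> Prev G' r y'} #
       ForPP' {(r, x, y') | r x. r \<in> \<Sigma>E \<and> x \<in> Prev G r y} # WhileR # K)"

definition initB ::
  "'a set \<Rightarrow> 'r set \<Rightarrow> ('v, 'r, 'a) fuzzy_graph \<Rightarrow> ('w, 'r, 'a) fuzzy_graph \<Rightarrow> ('v, 'w, 'r) config" where
  "initB \<Sigma>V \<Sigma>E G G' =
     ({(x, x'). x \<in> verts G \<and> x' \<in> verts G' \<and> label_le \<Sigma>V G G' x x'}, {},
      [ForPP (\<Sigma>E \<times> verts G \<times> verts G'), ForPP' (\<Sigma>E \<times> verts G \<times> verts G'), WhileR])"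

definition reachableB ::
  "'a set \<Rightarrow> 'r set \<Rightarrow> ('v, 'r, 'a) fuzzy_graph \<Rightarrow> ('w, 'r, 'a) fuzzy_graph \<Rightarrow>
   ('v, 'w, 'r) config \<Rightarrow> bool" where
  "reachableB \<Sigma>V \<Sigma>E G G' = (stepB \<Sigma>E G G')\<^sup>*\<^sup>* (initB \<Sigma>V \<Sigma>E G G')"

end

theory Submission
  imports Defs
begin

text \<open>
  ProcessPrev only moves pairs from \<open>Z\<close> to \<open>R\<close>, so \<open>U = Z \<union> R\<close> changes only when the main loop
  extracts a pair. Hence the threshold \<open>d\<close> computed on entry stays the correct supremum for \<open>U\<close>
  throughout each call. A pair violating the threshold cannot lie in any directed simulation
  contained in \<open>Z\<close>, so \<open>Z\<close> always contains the largest one. Conversely, each pair of \<open>Z\<close> satisfies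
  the two transfer conditions relative to \<open>U\<close> except for edges whose check is still pending on
  the stack: extracting \<open>(y, y')\<close> can only invalidate conditions that are put back on the stack by
  that same iteration. On termination the stack and \<open>R\<close> are empty, so \<open>Z = U\<close> is itself a directed
  simulation. Executions decrease \<open>card U\<close> and then a weight of the stack lexicographically.
\<close>

section \<open>Thresholds and matching successors\<close>

text \<open>A nonempty finite set attains its supremum; for the empty set the default value 0 lies
  below \<open>e\<close>, which is why \<open>e\<close> must be positive.\<close>

lemma le_sup01_iff:
  assumes "finite X" and "0 < e"
  shows "e \<le> sup01 X \<longleftrightarrow> (\<exists>u\<in>X. e \<le> u)"
proof (cases "X = {}")
  case False
  with assms(1) have "Sup X = Max X"
    by (simp add: cSup_eq_Max)
  with False assms(1) show ?thesis
    by (simp add: sup01_def Max_ge_iff)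
qed (use assms(2) in \<open>simp add: sup01_def\<close>)

locale fuzzy_graph_pair =
  fixes \<Sigma>V :: "'a set" and \<Sigma>E :: "'r set"
    and G :: "('v, 'r, 'a) fuzzy_graph" and G' :: "('w, 'r, 'a) fuzzy_graph"
  assumes finite_G: "finite_fuzzy_graph \<Sigma>V \<Sigma>E G"
    and finite_G': "finite_fuzzy_graph \<Sigma>V \<Sigma>E G'"
begin

lemma finite_verts [simp]: "finite (verts G)" "finite (verts G')" "finite \<Sigma>E"
  using finite_G finite_G' by (auto simp: finite_fuzzy_graph_def is_fuzzy_graph_def)

lemma finite_Prev [simp]: "finite (Prev G r y)" "finite (Prev G' r y')"
  by (auto simp: Prev_def)

definition match_fwd :: "('v \<times> 'w) set \<Rightarrow> 'r \<Rightarrow> 'v \<Rightarrow> 'w \<Rightarrow> real \<Rightarrow> bool" where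
  "match_fwd U r y x' e \<longleftrightarrow> (\<exists>y'\<in>verts G'. (y, y') \<in> U \<and> e \<le> edge G' x' r y')"

definition match_bwd :: "('v \<times> 'w) set \<Rightarrow> 'r \<Rightarrow> 'v \<Rightarrow> 'w \<Rightarrow> real \<Rightarrow> bool" where
  "match_bwd U r x y' e \<longleftrightarrow> (\<exists>y\<in>verts G. (y, y') \<in> U \<and> e \<le> edge G x r y)"

lemma le_bound_fwd_iff:
  assumes "0 < e"
  shows "e \<le> bound_fwd G' Z R r y x' \<longleftrightarrow> match_fwd (Z \<union> R) r y x' e"
proof -
  have "finite {edge G' x' r y' | y'. y' \<in> Next G' r x' \<and> (y, y') \<in> Z \<union> R}"
    by (rule finite_subset[of _ "edge G' x' r ` verts G'"]) (auto simp: Next_def)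
  from le_sup01_iff[OF this assms] assms show ?thesis
    unfolding bound_fwd_def match_fwd_def Next_def by force
qed

lemma le_bound_bwd_iff:
  assumes "0 < e"
  shows "e \<le> bound_bwd G Z R r x y' \<longleftrightarrow> match_bwd (Z \<union> R) r x y' e"
proof -
  have "finite {edge G x r y | y. y \<in> Next G r x \<and> (y, y') \<in> Z \<union> R}"
    by (rule finite_subset[of _ "edge G x r ` verts G"]) (auto simp: Next_def)
  from le_sup01_iff[OF this assms] assms show ?thesis
    unfolding bound_bwd_def match_bwd_def Next_def by force
qed

section \<open>Invariants of configurations\<close>

fun stmt_ok :: "('v \<times> 'w) set \<Rightarrow> ('v, 'w, 'r) stmt \<Rightarrow> bool" where
  "stmt_ok U (ForPP T) \<longleftrightarrow> T \<subseteq> \<Sigma>E \<times> verts G \<times> verts G'"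
| "stmt_ok U (ForPP' T) \<longleftrightarrow> T \<subseteq> \<Sigma>E \<times> verts G \<times> verts G'"
| "stmt_ok U (PPLoop r y x' d S) \<longleftrightarrow>
     r \<in> \<Sigma>E \<and> y \<in> verts G \<and> x' \<in> verts G' \<and> S \<subseteq> Prev G r y \<and>
     (\<forall>e>0. e \<le> d \<longleftrightarrow> match_fwd U r y x' e)"
| "stmt_ok U (PPLoop' r x y' d S) \<longleftrightarrow>
     r \<in> \<Sigma>E \<and> x \<in> verts G \<and> y' \<in> verts G' \<and> S \<subseteq> Prev G' r y' \<and>
     (\<forall>e>0. e \<le> d \<longleftrightarrow> match_bwd U r x y' e)"
| "stmt_ok U WhileR \<longleftrightarrow> True"

text \<open>
  \<open>pending_fwd s r x y x'\<close>: executing \<open>s\<close> will still test \<open>(x, x')\<close> against the edge from \<open>x\<close> to \<open>y\<close>;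
  \<open>pending_bwd s r x x' y'\<close>: executing \<open>s\<close> will still test \<open>(x, x')\<close> against the edge from \<open>x'\<close> to \<open>y'\<close>.
\<close>

fun pending_fwd :: "('v, 'w, 'r) stmt \<Rightarrow> 'r \<Rightarrow> 'v \<Rightarrow> 'v \<Rightarrow> 'w \<Rightarrow> bool" where
  "pending_fwd (ForPP T) r x y x' \<longleftrightarrow> (r, y, x') \<in> T"
| "pending_fwd (PPLoop r0 y0 x0' d S) r x y x' \<longleftrightarrow> r = r0 \<and> y = y0 \<and> x' = x0' \<and> x \<in> S"
| "pending_fwd _ r x y x' \<longleftrightarrow> False"

fun pending_bwd :: "('v, 'w, 'r) stmt \<Rightarrow> 'r \<Rightarrow> 'v \<Rightarrow> 'w \<Rightarrow> 'w \<Rightarrow> bool" where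
  "pending_bwd (ForPP' T) r x x' y' \<longleftrightarrow> (r, x, y') \<in> T"
| "pending_bwd (PPLoop' r0 x0 y0' d S) r x x' y' \<longleftrightarrow> r = r0 \<and> x = x0 \<and> y' = y0' \<and> x' \<in> S"
| "pending_bwd _ r x x' y' \<longleftrightarrow> False"

definition fwd_inv :: "('v, 'w, 'r) config \<Rightarrow> bool" where
  "fwd_inv = (\<lambda>(Z, R, K). \<forall>x x' r y. (x, x') \<in> Z \<longrightarrow> r \<in> \<Sigma>E \<longrightarrow> y \<in> verts G \<longrightarrow> edge G x r y > 0 \<longrightarrow>
     match_fwd (Z \<union> R) r y x' (edge G x r y) \<or> (\<exists>s\<in>set K. pending_fwd s r x y x'))"

definition bwd_inv :: "('v, 'w, 'r) config \<Rightarrow> bool" where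
  "bwd_inv = (\<lambda>(Z, R, K). \<forall>x x' r y'. (x, x') \<in> Z \<longrightarrow> r \<in> \<Sigma>E \<longrightarrow> y' \<in> verts G' \<longrightarrow> edge G' x' r y' > 0 \<longrightarrow>
     match_bwd (Z \<union> R) r x y' (edge G' x' r y') \<or> (\<exists>s\<in>set K. pending_bwd s r x x' y'))"

text \<open>Disjointness of \<open>Z\<close> and \<open>R\<close> makes each extraction shrink the
  union. The unique \<open>WhileR\<close> at the bottom ensures that nothing lies below it when it
  is on top.\<close>

definition stack_inv :: "('v, 'w, 'r) config \<Rightarrow> bool" where
  "stack_inv = (\<lambda>(Z, R, K).
     Z \<union> R \<subseteq> verts G \<times> verts G' \<and> Z \<inter> R = {} \<and> (\<forall>(x, x')\<in>Z. label_le \<Sigma>V G G' x x') \<and>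
     (\<forall>s\<in>set K. stmt_ok (Z \<union> R) s) \<and>
     (K = [] \<and> R = {} \<or> (\<exists>K0. K = K0 @ [WhileR] \<and> WhileR \<notin> set K0)))"

definition sound_inv :: "('v, 'w, 'r) config \<Rightarrow> bool" where
  "sound_inv = (\<lambda>(Z, R, K). largest_directed_simulation \<Sigma>V \<Sigma>E G G' \<subseteq> Z)"

section \<open>Preservation of the invariants\<close>

lemma move_union [simp]: "p \<in> Z \<Longrightarrow> insert p (Z - {p} \<union> R) = Z \<union> R"
  by auto

lemma stack_inv_step:
  assumes "stepB \<Sigma>E G G' c c'" and "stack_inv c"
  shows "stack_inv c'"
  using assms(1)
proof (cases rule: stepB.cases)
  case (ForPP_call r y x' T Z R K)
  with assms(2) show ?thesis
    by (auto simp: stack_inv_def le_bound_fwd_iff Cons_eq_append_conv)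
next
  case (ForPP'_call r x y' T Z R K)
  with assms(2) show ?thesis
    by (auto simp: stack_inv_def le_bound_bwd_iff Cons_eq_append_conv)
next
  case (PPLoop_move x S r y d x' Z R K)
  with assms(2) show ?thesis
    by (auto simp: stack_inv_def Cons_eq_append_conv)
next
  case (PPLoop'_move x' S r y' d x Z R K)
  with assms(2) show ?thesis
    by (auto simp: stack_inv_def Cons_eq_append_conv)
next
  case (WhileR_iter y y' R Z K)
  with assms(2) have "K = []"
    by (auto simp: stack_inv_def Cons_eq_append_conv)
  with WhileR_iter assms(2) show ?thesis
    by (auto simp: stack_inv_def Prev_def Cons_eq_append_conv)
qed (use assms(2) in \<open>auto simp: stack_inv_def Cons_eq_append_conv\<close>)

text \<open>If a moved pair were in the largest simulation, its partner pair would be there too,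
  hence in \<open>Z\<close> by the invariant, and would be the match that the threshold
  excludes.\<close>

lemma sound_inv_step:
  assumes "stepB \<Sigma>E G G' c c'" and "stack_inv c" and "sound_inv c"
  shows "sound_inv c'"
proof -
  note sim = directed_simulation_largest[of \<Sigma>V \<Sigma>E G G', unfolded directed_simulation_def]
  show ?thesis
    using assms(1)
  proof (cases rule: stepB.cases)
    case (PPLoop_move x S r y d x' Z R K)
    \<comment> \<open>The edge is positive by \<open>S \<subseteq> Prev G r y\<close>, so
      \<open>stmt_ok\<close> applies with \<open>e = edge G x r y\<close> and turns
      \<open>\<not> e \<le> d\<close> into the absence of a match.\<close>
    with assms(2) have ok: "r \<in> \<Sigma>E" "y \<in> verts G" "x' \<in> verts G'" "x \<in> verts G" "edge G x r y > 0"
      and not_match: "\<not> match_fwd (Z \<union> R) r y x' (edge G x r y)"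
      by (auto simp: stack_inv_def Prev_def not_le[symmetric])
    have "(x, x') \<notin> largest_directed_simulation \<Sigma>V \<Sigma>E G G'"
    proof
      assume "(x, x') \<in> largest_directed_simulation \<Sigma>V \<Sigma>E G G'"
      with sim ok obtain y' where "y' \<in> verts G'" "(y, y') \<in> largest_directed_simulation \<Sigma>V \<Sigma>E G G'"
        "edge G x r y \<le> edge G' x' r y'"
        by meson
      with assms(3) not_match PPLoop_move show False
        by (auto simp: sound_inv_def match_fwd_def)
    qed
    with PPLoop_move assms(3) show ?thesis
      by (auto simp: sound_inv_def)
  next
    case (PPLoop'_move x' S r y' d x Z R K)
    with assms(2) have ok: "r \<in> \<Sigma>E" "x \<in> verts G" "y' \<in> verts G'" "x' \<in> verts G'" "edge G' x' r y' > 0"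
      and not_match: "\<not> match_bwd (Z \<union> R) r x y' (edge G' x' r y')"
      by (auto simp: stack_inv_def Prev_def not_le[symmetric])
    have "(x, x') \<notin> largest_directed_simulation \<Sigma>V \<Sigma>E G G'"
    proof
      assume "(x, x') \<in> largest_directed_simulation \<Sigma>V \<Sigma>E G G'"
      with sim ok obtain y where "y \<in> verts G" "(y, y') \<in> largest_directed_simulation \<Sigma>V \<Sigma>E G G'"
        "edge G' x' r y' \<le> edge G x r y"
        by meson
      with assms(3) not_match PPLoop'_move show False
        by (auto simp: sound_inv_def match_bwd_def)
    qed
    with PPLoop'_move assms(3) show ?thesis
      by (auto simp: sound_inv_def)
  qed (use assms(3) in \<open>auto simp: sound_inv_def\<close>)
qed

lemma fwd_inv_step:
  assumes "stepB \<Sigma>E G G' c c'" and "stack_inv c" and "fwd_inv c"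
  shows "fwd_inv c'"
  using assms(1)
proof (cases rule: stepB.cases)
  case (ForPP_call r y x' T Z R K)
  \<comment> \<open>A check pending in \<open>T\<close> passes to the new \<open>PPLoop\<close>: its
    \<open>x\<close> lies in \<open>Prev G r y\<close>, since \<open>Z\<close> contains only pairs
    of vertices.\<close>
  with assms(2,3) show ?thesis
    by (fastforce simp: fwd_inv_def Prev_def stack_inv_def)
next
  case (PPLoop_move x S r y d x' Z R K)
  with assms(3) show ?thesis
    by (auto simp: fwd_inv_def)
next
  case (PPLoop'_move x' S r y' d x Z R K)
  with assms(3) show ?thesis
    by (auto simp: fwd_inv_def)
next
  case (PPLoop_skip x S r y d x' Z R K)
  with assms(2) have "match_fwd (Z \<union> R) r y x' (edge G x r y)" if "(x, x') \<in> Z" "edge G x r y > 0"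
    using that by (auto simp: stack_inv_def)
  with PPLoop_skip assms(3) show ?thesis
    by (auto simp: fwd_inv_def)
next
  case (WhileR_iter y y' R Z K)
  \<comment> \<open>Only a match through \<open>(y, y')\<close> can be lost; then
    \<open>u = y\<close>, and the positive edge from \<open>x'\<close> to \<open>y'\<close> puts
    \<open>x'\<close> among the predecessors scheduled by this iteration.\<close>
  have "match_fwd (Z \<union> (R - {(y, y')})) r u x' (edge G x r u) \<or> u = y \<and> x' \<in> Prev G' r y'"
    if "(x, x') \<in> Z" "edge G x r u > 0" "match_fwd (Z \<union> R) r u x' (edge G x r u)" for x x' r u
  proof -
    have "x' \<in> verts G'"
      using that(1) assms(2) WhileR_iter by (auto simp: stack_inv_def)
    with that(2,3) show ?thesis
      by (fastforce simp: match_fwd_def Prev_def)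
  qed
  moreover have "K = []"
    using assms(2) WhileR_iter by (auto simp: stack_inv_def Cons_eq_append_conv)
  ultimately show ?thesis
    using WhileR_iter assms(3) by (fastforce simp: fwd_inv_def)
qed (use assms(3) in \<open>auto simp: fwd_inv_def\<close>)

text \<open>Dual to \<open>fwd_inv_step\<close>: a match lost by extracting \<open>(y, y')\<close>
  used the edge from \<open>x\<close> to \<open>y\<close>, so \<open>x \<in> Prev G r y\<close> is
  rescheduled.\<close>

lemma bwd_inv_step:
  assumes "stepB \<Sigma>E G G' c c'" and "stack_inv c" and "bwd_inv c"
  shows "bwd_inv c'"
  using assms(1)
proof (cases rule: stepB.cases)
  case (ForPP'_call r x y' T Z R K)
  with assms(2,3) show ?thesis
    by (fastforce simp: bwd_inv_def Prev_def stack_inv_def)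
next
  case (PPLoop_move x S r y d x' Z R K)
  with assms(3) show ?thesis
    by (auto simp: bwd_inv_def)
next
  case (PPLoop'_move x' S r y' d x Z R K)
  with assms(3) show ?thesis
    by (auto simp: bwd_inv_def)
next
  case (PPLoop'_skip x' S r y' d x Z R K)
  with assms(2) have "match_bwd (Z \<union> R) r x y' (edge G' x' r y')" if "(x, x') \<in> Z" "edge G' x' r y' > 0"
    using that by (auto simp: stack_inv_def)
  with PPLoop'_skip assms(3) show ?thesis
    by (auto simp: bwd_inv_def)
next
  case (WhileR_iter y y' R Z K)
  have "match_bwd (Z \<union> (R - {(y, y')})) r x u' (edge G' x' r u') \<or> u' = y' \<and> x \<in> Prev G r y"
    if "(x, x') \<in> Z" "edge G' x' r u' > 0" "match_bwd (Z \<union> R) r x u' (edge G' x' r u')" for x x' r u'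
  proof -
    have "x \<in> verts G"
      using that(1) assms(2) WhileR_iter by (auto simp: stack_inv_def)
    with that(2,3) show ?thesis
      by (fastforce simp: match_bwd_def Prev_def)
  qed
  moreover have "K = []"
    using assms(2) WhileR_iter by (auto simp: stack_inv_def Cons_eq_append_conv)
  ultimately show ?thesis
    using WhileR_iter assms(3) by (fastforce simp: bwd_inv_def)
qed (use assms(3) in \<open>auto simp: bwd_inv_def\<close>)

definition invB :: "('v, 'w, 'r) config \<Rightarrow> bool" where
  "invB c \<longleftrightarrow> stack_inv c \<and> sound_inv c \<and> fwd_inv c \<and> bwd_inv c"

text \<open>The two initial loops range over all triples, so every transfer condition starts out
  pending.\<close>

lemma invB_init: "invB (initB \<Sigma>V \<Sigma>E G G')"
proof -
  have "stack_inv (initB \<Sigma>V \<Sigma>E G G')" "fwd_inv (initB \<Sigma>V \<Sigma>E G G')" "bwd_inv (initB \<Sigma>V \<Sigma>E G G')"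
    by (auto simp: initB_def stack_inv_def fwd_inv_def bwd_inv_def Cons_eq_append_conv)
  moreover have "sound_inv (initB \<Sigma>V \<Sigma>E G G')"
    using directed_simulation_largest[of \<Sigma>V \<Sigma>E G G']
    by (fastforce simp: initB_def sound_inv_def directed_simulation_def)
  ultimately show ?thesis
    by (simp add: invB_def)
qed

lemma invB_step: "stepB \<Sigma>E G G' c c' \<Longrightarrow> invB c \<Longrightarrow> invB c'"
  unfolding invB_def by (blast intro: stack_inv_step sound_inv_step fwd_inv_step bwd_inv_step)

lemma invB_reachable:
  assumes "reachableB \<Sigma>V \<Sigma>E G G' c"
  shows "invB c"
  using assms unfolding reachableB_def
  by (induction rule: rtranclp_induct) (auto intro: invB_init invB_step)

section \<open>Termination\<close>

text \<open>The summand 1 pays for the step that discards a finished statement. Each triple of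
  \<open>T\<close> costs \<open>card (verts G) + 2\<close>: at most
  \<open>1 + card (verts G)\<close> for the \<open>PPLoop\<close> it spawns, and 1 for a strict
  decrease at the call.\<close>

fun weight :: "('v, 'w, 'r) stmt \<Rightarrow> nat" where
  "weight (ForPP T) = 1 + card T * (card (verts G) + 2)"
| "weight (ForPP' T) = 1 + card T * (card (verts G') + 2)"
| "weight (PPLoop r y x' d S) = 1 + card S"
| "weight (PPLoop' r x y' d S) = 1 + card S"
| "weight WhileR = 1"

lemma weight_call:
  assumes "finite T" and "t \<in> T" and "m \<le> n"
  shows "Suc m + (1 + card (T - {t}) * (n + 2)) < 1 + card T * (n + 2)"
proof -
  have "card T = Suc (card (T - {t}))"
    using assms by (metis card.remove)
  with assms(3) show ?thesis
    by simp
qed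

lemma stepB_decreases:
  assumes "stepB \<Sigma>E G G' c c'" and "stack_inv c"
  shows "(c', c) \<in> measures [\<lambda>(Z, R, K). card (Z \<union> R), \<lambda>(Z, R, K). sum_list (map weight K)]"
proof -
  \<comment> \<open>Infinite sets have \<open>card\<close> 0, so the loop sets must be known to be
    finite before removing an element lowers the weight.\<close>
  have fin: "finite T" if "T \<subseteq> \<Sigma>E \<times> verts G \<times> verts G'" for T
    using that by (rule finite_subset) simp
  have finV: "finite S" if "S \<subseteq> Prev G r y" for S r y
    using that by (rule finite_subset) simp
  have finV': "finite S" if "S \<subseteq> Prev G' r y" for S r y
    using that by (rule finite_subset) simp
  show ?thesis
    using assms(1)
  proof (cases rule: stepB.cases)
    case (ForPP_call r y x' T Z R K)
    moreover have "card (Prev G r y) \<le> card (verts G)"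
      by (rule card_mono) (auto simp: Prev_def)
    ultimately show ?thesis
      using assms(2) weight_call[of T "(r, y, x')" "card (Prev G r y)" "card (verts G)"] fin[of T]
      by (simp add: stack_inv_def)
  next
    case (ForPP'_call r x y' T Z R K)
    moreover have "card (Prev G' r y') \<le> card (verts G')"
      by (rule card_mono) (auto simp: Prev_def)
    ultimately show ?thesis
      using assms(2) weight_call[of T "(r, x, y')" "card (Prev G' r y')" "card (verts G')"] fin[of T]
      by (simp add: stack_inv_def)
  next
    case (PPLoop_move x S r y d x' Z R K)
    then have "card (S - {x}) < card S"
      using assms(2) finV[of S r y] by (intro card_Diff1_less) (auto simp: stack_inv_def)
    with PPLoop_move show ?thesis
      by simp
  next
    case (PPLoop'_move x' S r y' d x Z R K)
    then have "card (S - {x'}) < card S"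
      using assms(2) finV'[of S r y'] by (intro card_Diff1_less) (auto simp: stack_inv_def)
    with PPLoop'_move show ?thesis
      by simp
  next
    case (PPLoop_skip x S r y d x' Z R K)
    then have "card (S - {x}) < card S"
      using assms(2) finV[of S r y] by (intro card_Diff1_less) (auto simp: stack_inv_def)
    with PPLoop_skip show ?thesis
      by simp
  next
    case (PPLoop'_skip x' S r y' d x Z R K)
    then have "card (S - {x'}) < card S"
      using assms(2) finV'[of S r y'] by (intro card_Diff1_less) (auto simp: stack_inv_def)
    with PPLoop'_skip show ?thesis
      by simp
  next
    case (WhileR_iter y y' R Z K)
    then have "finite (Z \<union> R)"
      using assms(2) by (auto simp: stack_inv_def intro: finite_subset)
    \<comment> \<open>The extracted pair is not in \<open>Z\<close>, by disjointness, so it really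
      leaves the union.\<close>
    then have "card (Z \<union> (R - {(y, y')})) < card (Z \<union> R)"
      using assms(2) WhileR_iter by (intro psubset_card_mono) (auto simp: stack_inv_def)
    with WhileR_iter show ?thesis
      by simp
  qed simp_all
qed

lemma stepB_terminates:
  assumes "c 0 = initB \<Sigma>V \<Sigma>E G G'" and "\<And>n. stepB \<Sigma>E G G' (c n) (c (Suc n))"
  shows False
proof -
  have inv: "invB (c n)" for n
    using assms by (induction n) (auto intro: invB_init invB_step)
  have "(c (Suc n), c n) \<in>
      measures [\<lambda>(Z, R, K). card (Z \<union> R), \<lambda>(Z, R, K). sum_list (map weight K)]" for n
    using stepB_decreases[OF assms(2)] inv[of n] by (simp only: invB_def)
  then show False
    using wf_measures unfolding wf_iff_no_infinite_down_chain by blast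
qed

section \<open>Stuck configurations and the returned relation\<close>

text \<open>The guards are exhaustive for every statement on top of the stack: a loop set or
  \<open>R\<close> is empty or has an element, and the move and skip conditions are
  complementary.\<close>

lemma stepB_progress:
  assumes "\<nexists>c'. stepB \<Sigma>E G G' (Z, R, K) c'"
  shows "K = []"
proof (rule ccontr)
  assume "K \<noteq> []"
  then obtain s K' where K: "K = s # K'"
    by (cases K) auto
  show False
  proof (cases s)
    case (ForPP T)
    then show False
      using assms K by (cases "T = {}") (fastforce intro: stepB.intros)+
  next
    case (ForPP' T)
    then show False
      using assms K by (cases "T = {}") (fastforce intro: stepB.intros)+
  next
    case (PPLoop r y x' d S)
    then show False
      using assms K by (metis ex_in_conv stepB.PPLoop_done stepB.PPLoop_move stepB.PPLoop_skip)
  next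
    case (PPLoop' r x y' d S)
    then show False
      using assms K by (metis ex_in_conv stepB.PPLoop'_done stepB.PPLoop'_move stepB.PPLoop'_skip)
  next
    case WhileR
    then show False
      using assms K by (cases "R = {}") (fastforce intro: stepB.intros)+
  qed
qed

text \<open>Nothing is pending on the empty stack and \<open>stack_inv\<close> forces
  \<open>R = {}\<close>, so the matches required by the invariants lie in \<open>Z\<close>
  itself.\<close>

lemma invB_final:
  assumes "invB (Z, R, [])"
  shows "Z = largest_directed_simulation \<Sigma>V \<Sigma>E G G'"
proof
  have "directed_simulation \<Sigma>V \<Sigma>E G G' Z"
    using assms
    by (auto simp: invB_def stack_inv_def fwd_inv_def bwd_inv_def directed_simulation_def
        match_fwd_def match_bwd_def)
  then show "Z \<subseteq> largest_directed_simulation \<Sigma>V \<Sigma>E G G'"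
    by (auto simp: largest_directed_simulation_def)
  show "largest_directed_simulation \<Sigma>V \<Sigma>E G G' \<subseteq> Z"
    using assms by (simp add: invB_def sound_inv_def)
qed

end

theorem theorem3:
  fixes \<Sigma>V :: "'a set" and \<Sigma>E :: "'r set"
    and G :: "('v, 'r, 'a) fuzzy_graph" and G' :: "('w, 'r, 'a) fuzzy_graph"
  assumes "finite_fuzzy_graph \<Sigma>V \<Sigma>E G" and "finite_fuzzy_graph \<Sigma>V \<Sigma>E G'"
  shows "\<not> (\<exists>c :: nat \<Rightarrow> ('v, 'w, 'r) config.
            c 0 = initB \<Sigma>V \<Sigma>E G G' \<and> (\<forall>n. stepB \<Sigma>E G G' (c n) (c (Suc n)))) \<and>
         (\<forall>Z R K. reachableB \<Sigma>V \<Sigma>E G G' (Z, R, K) \<and> (\<nexists>c'. stepB \<Sigma>E G G' (Z, R, K) c') \<longrightarrow>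
            K = [] \<and> Z = largest_directed_simulation \<Sigma>V \<Sigma>E G G')"
proof -
  interpret fuzzy_graph_pair \<Sigma>V \<Sigma>E G G'
    using assms by unfold_locales
  show ?thesis
    using stepB_terminates stepB_progress invB_reachable invB_final by blast
qed

end
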